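(* When $\alpha=0$, the MM-DEA model $$\begin{array}{ll}\text{maximize} & y_o^{\top}v-\alpha t'\\ \text{subject to} & x_o^{\top}u'=t',\\ & y_o^{\top}v\le 1,\\ & y_i^{\top}v\le x_i^{\top}u'\quad\forall i\in I\setminus\{o\},\\ & u'\ge 0,\ v\ge 0,\\ & 0\le t'\le 1\end{array}$$ reduces to the CCR model $$\begin{array}{ll}\text{maximize} & \theta_o=y_o^{\top}v\\ \text{subject to} & x_o^{\top}u=1,\\ & Y^{\top}v\le X^{\top}u,\\ & u\ge 0,\ v\ge 0.\end{array}$$
   Context: There are $n$ decision making units (DMUs), indexed by $I=\{1,\dots,n\}$. DMU $i$ has input vector $x_i\in\mathbb{R}^l$ and output vector $y_i\in\mathbb{R}^m$, and all inputs and outputs are assumed strictly positive, i.e. $x_i>0$ and $y_i>0$ componentwise for every $i\in I$. Write $X=[x_1,\dots,x_n]$ and $Y=[y_1,\dots,y_n]$. The index $o\in I$ denotes the DMU being evaluated. The first problem, a linear program in the variables $u'\in\mathbb{R}^l$, $v\in\mathbb{R}^m$, $t'\in\mathbb{R}$ with trade-off parameter $\alpha\ge 0$, is the MM-DEA (Maximum-Margin Data Envelopment Analysis) model in linear programming form. The second, a linear program in the variables $u\in\mathbb{R}^l$, $v\in\mathbb{R}^m$, is the CCR (Charnes-Cooper-Rhodes) model, whose optimal value is the CCR efficiency score of DMU $o$. Vector inequalities are componentwise. *)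

theory Defs
  imports "HOL-Analysis.Analysis"
begin

text \<open>
  DMUs are indexed by a finite type \<open>'n\<close>, so that \<open>I = UNIV\<close>.  The data of DMU \<open>i\<close> are the
  columns of the matrices \<open>X\<close> and \<open>Y\<close>, that is, \<open>x\<^sub>i = column i X\<close> and \<open>y\<^sub>i = column i Y\<close>.
  The evaluated DMU is called \<open>k\<close>, as \<open>o\<close> is reserved syntax for function composition.
  The order \<open>\<le>\<close> on vectors is the componentwise one; the library's strict order on vectors
  is not componentwise, hence the entrywise formulation of positivity.
\<close>

definition positive_data :: "real^'n^'l \<Rightarrow> real^'n^'m \<Rightarrow> bool" where
  "positive_data X Y \<longleftrightarrow>
     (\<forall>i. (\<forall>j. 0 < column i X $ j) \<and> (\<forall>r. 0 < column i Y $ r))"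

definition mm_dea_feasible ::
    "real^'n^'l \<Rightarrow> real^'n^'m \<Rightarrow> 'n \<Rightarrow> ((real^'l) \<times> (real^'m) \<times> real) set" where
  "mm_dea_feasible X Y k = {(u', v, t').
     column k X \<bullet> u' = t' \<and>
     column k Y \<bullet> v \<le> 1 \<and>
     (\<forall>i \<in> UNIV - {k}. column i Y \<bullet> v \<le> column i X \<bullet> u') \<and>
     0 \<le> u' \<and> 0 \<le> v \<and>
     0 \<le> t' \<and> t' \<le> 1}"

definition mm_dea_objective ::
    "real^'n^'m \<Rightarrow> 'n \<Rightarrow> real \<Rightarrow> (real^'l) \<times> (real^'m) \<times> real \<Rightarrow> real" where
  "mm_dea_objective Y k \<alpha> = (\<lambda>(u', v, t'). column k Y \<bullet> v - \<alpha> * t')"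

definition ccr_feasible ::
    "real^'n^'l \<Rightarrow> real^'n^'m \<Rightarrow> 'n \<Rightarrow> ((real^'l) \<times> (real^'m)) set" where
  "ccr_feasible X Y k = {(u, v).
     column k X \<bullet> u = 1 \<and>
     transpose Y *v v \<le> transpose X *v u \<and>
     0 \<le> u \<and> 0 \<le> v}"

definition ccr_objective ::
    "real^'n^'m \<Rightarrow> 'n \<Rightarrow> (real^'l) \<times> (real^'m) \<Rightarrow> real" where
  "ccr_objective Y k = (\<lambda>(u, v). column k Y \<bullet> v)"

text \<open>
  A maximization problem is given by its feasible set and objective function.  The optimal value
  is taken in the extended reals, so that it is meaningful without assuming
  feasibility or boundedness.
\<close>

definition optimal_value :: "'z set \<Rightarrow> ('z \<Rightarrow> real) \<Rightarrow> ereal" where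
  "optimal_value F f = (SUP z\<in>F. ereal (f z))"

definition optimal_solution :: "'z set \<Rightarrow> ('z \<Rightarrow> real) \<Rightarrow> 'z \<Rightarrow> bool" where
  "optimal_solution F f z \<longleftrightarrow> is_arg_max f (\<lambda>w. w \<in> F) z"

end

theory Submission
  imports Defs
begin

text \<open>
  A pair \<open>(u, v)\<close> is CCR feasible iff \<open>(u, v, 1)\<close> is MM-DEA feasible. When \<open>\<alpha> = 0\<close>, a smaller \<open>t'\<close>
  brings no gain: positivity of \<open>x\<^sub>o\<close> lets one increase an entry of \<open>u'\<close> until \<open>x\<^sub>o\<^sup>\<top> u' = 1\<close>. This
  only relaxes the constraints of the other DMUs, and leaves \<open>v\<close>, hence the objective, unchanged.
\<close>

lemma transpose_mult_vec_nth: "(transpose A *v w) $ i = column i A \<bullet> w"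
  for A :: "real^'n^'m"
  by (simp add: matrix_vector_mult_def transpose_def column_def inner_vec_def)

text \<open>Both objectives take the same set of values, so the suprema agree in
  \<open>ereal\<close>, including the infeasible and unbounded cases.\<close>

lemma optimal_value_eqI:
  assumes "\<And>z. z \<in> F \<Longrightarrow> \<exists>w\<in>G. f z = g w" and "\<And>w. w \<in> G \<Longrightarrow> \<exists>z\<in>F. f z = g w"
  shows "optimal_value F f = optimal_value G g"
  unfolding optimal_value_def
proof (rule SUP_eq)
  show "\<exists>w\<in>G. ereal (f z) \<le> ereal (g w)" if "z \<in> F" for z
    using assms(1)[OF that] by force
  show "\<exists>z\<in>F. ereal (g w) \<le> ereal (f z)" if "w \<in> G" for w
    using assms(2)[OF that] by force
qed

lemma optimal_solution_iff:
  "optimal_solution F f z \<longleftrightarrow> z \<in> F \<and> (\<forall>w\<in>F. f w \<le> f z)"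
  by (auto simp: optimal_solution_def is_arg_max_def not_less)

text \<open>Matching values in one direction suffices: each value of \<open>g\<close> on
  \<open>G\<close> is a value of \<open>f\<close> on \<open>F\<close>, hence at most
  \<open>f z\<close>, and \<open>w\<close> reaches this bound.\<close>

lemma optimal_solution_transfer:
  assumes "optimal_solution F f z" and "w \<in> G" and "g w = f z"
    and "\<And>w. w \<in> G \<Longrightarrow> \<exists>z\<in>F. f z = g w"
  shows "optimal_solution G g w"
  using assms by (metis optimal_solution_iff)

text \<open>With \<open>column k X \<bullet> u = 1\<close>, row \<open>k\<close> of the CCR matrix
  inequality is exactly the MM-DEA bound \<open>column k Y \<bullet> v \<le> 1\<close>; the
  remaining rows are the constraints of the other DMUs.\<close>

lemma ccr_feasible_iff_mm_dea_feasible: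
  "(u, v) \<in> ccr_feasible X Y k \<longleftrightarrow> (u, v, 1) \<in> mm_dea_feasible X Y k"
proof -
  have "transpose Y *v v \<le> transpose X *v u \<longleftrightarrow>
      column k Y \<bullet> v \<le> column k X \<bullet> u \<and> (\<forall>i\<in>UNIV - {k}. column i Y \<bullet> v \<le> column i X \<bullet> u)"
    unfolding less_eq_vec_def transpose_mult_vec_nth by auto
  then show ?thesis
    unfolding ccr_feasible_def mm_dea_feasible_def by auto
qed

lemma mm_dea_objective_0 [simp]: "mm_dea_objective Y k 0 (u, v, t) = ccr_objective Y k (u, v)"
  by (simp add: mm_dea_objective_def ccr_objective_def)

lemma mm_dea_feasible_imp_ccr_feasible:
  fixes X :: "real^'n^'l" and Y :: "real^'n^'m"
  assumes "positive_data X Y" and "(u', v, t') \<in> mm_dea_feasible X Y k"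
  shows "\<exists>u. (u, v) \<in> ccr_feasible X Y k"
proof -
  \<comment> \<open>Index types are nonempty, so some input coordinate exists; any one will
    do.\<close>
  obtain j :: 'l where True by blast
  have pos: "0 < column i X $ j" for i
    using assms(1) by (simp add: positive_data_def)
  \<comment> \<open>The increment is chosen so that \<open>column k X $ j * c\<close> equals
    \<open>1 - t'\<close>, the amount missing from the normalization; it is nonnegative because
    \<open>t' \<le> 1\<close>.\<close>
  define c where "c = (1 - t') / column k X $ j"
  define u where "u = u' + axis j c"
  have "0 \<le> c"
    using assms(2) pos[of k] by (simp add: c_def mm_dea_feasible_def)
  have inner_u: "column i X \<bullet> u = column i X \<bullet> u' + column i X $ j * c" for i
    by (simp add: u_def inner_add_right inner_axis)
  have mono: "column i X \<bullet> u' \<le> column i X \<bullet> u" for i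
    using inner_u pos[of i] \<open>0 \<le> c\<close> by simp
  have "column k X \<bullet> u = 1"
    using inner_u[of k] assms(2) pos[of k] by (simp add: c_def mm_dea_feasible_def)
  moreover have "0 \<le> u"
    using assms(2) \<open>0 \<le> c\<close> by (simp add: u_def mm_dea_feasible_def less_eq_vec_def axis_def)
  moreover have "\<forall>i\<in>UNIV - {k}. column i Y \<bullet> v \<le> column i X \<bullet> u"
    using assms(2) mono unfolding mm_dea_feasible_def by (auto intro: order_trans)
  ultimately have "(u, v, 1) \<in> mm_dea_feasible X Y k"
    using assms(2) by (simp add: mm_dea_feasible_def)
  then show ?thesis
    using ccr_feasible_iff_mm_dea_feasible by blast
qed

theorem proposition3p1:
  fixes X :: "real^'n^'l" and Y :: "real^'n^'m" and k :: 'n and \<alpha> :: real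
  assumes "positive_data X Y" and "\<alpha> = 0"
  shows
    "(\<forall>u v. (u, v) \<in> ccr_feasible X Y k \<longleftrightarrow> (u, v, 1) \<in> mm_dea_feasible X Y k) \<and>
     (\<forall>u v. mm_dea_objective Y k \<alpha> (u :: real^'l, v, 1) = ccr_objective Y k (u, v)) \<and>
     (\<forall>u' v t'. (u', v, t') \<in> mm_dea_feasible X Y k \<longrightarrow>
        (\<exists>u. (u, v) \<in> ccr_feasible X Y k \<and>
             ccr_objective Y k (u, v) = mm_dea_objective Y k \<alpha> (u', v, t'))) \<and>
     optimal_value (mm_dea_feasible X Y k) (mm_dea_objective Y k \<alpha>) =
       optimal_value (ccr_feasible X Y k) (ccr_objective Y k) \<and>
     (\<forall>u v. optimal_solution (ccr_feasible X Y k) (ccr_objective Y k) (u, v) \<longleftrightarrow>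
        optimal_solution (mm_dea_feasible X Y k) (mm_dea_objective Y k \<alpha>) (u, v, 1)) \<and>
     (\<forall>u' v t'. optimal_solution (mm_dea_feasible X Y k) (mm_dea_objective Y k \<alpha>) (u', v, t') \<longrightarrow>
        (\<exists>u. optimal_solution (ccr_feasible X Y k) (ccr_objective Y k) (u, v)))"
proof -
  let ?F = "mm_dea_feasible X Y k" and ?G = "ccr_feasible X Y k"
  let ?f = "mm_dea_objective Y k \<alpha> :: (real^'l) \<times> (real^'m) \<times> real \<Rightarrow> real"
  let ?g = "ccr_objective Y k :: (real^'l) \<times> (real^'m) \<Rightarrow> real"
  \<comment> \<open>Here \<open>u\<close> and \<open>u'\<close> are unrelated: for
    \<open>\<alpha> = 0\<close> both objectives depend on \<open>v\<close> alone.\<close>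
  have obj: "?f (u, v, t) = ?g (u', v)" for u v t u'
    using assms(2) by (simp add: ccr_objective_def)
  have lift: "\<exists>u. (u, v) \<in> ?G" if "(u', v, t') \<in> ?F" for u' v t'
    using mm_dea_feasible_imp_ccr_feasible[OF assms(1) that] .
  have FG: "\<exists>w\<in>?G. ?f z = ?g w" if "z \<in> ?F" for z
    using that lift obj by (cases z) blast
  have GF: "\<exists>z\<in>?F. ?f z = ?g w" if "w \<in> ?G" for w
    using that obj ccr_feasible_iff_mm_dea_feasible by (cases w) blast
  \<comment> \<open>By \<open>FG\<close>, points with \<open>t' < 1\<close> attain no value beyond
    those of CCR, so the CCR optimum remains optimal over all of \<open>?F\<close>.\<close>
  have optF: "optimal_solution ?F ?f (u, v, 1)" if "optimal_solution ?G ?g (u, v)" for u v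
  proof (rule optimal_solution_transfer[OF that])
    show "(u, v, 1) \<in> ?F"
      using that ccr_feasible_iff_mm_dea_feasible by (metis optimal_solution_iff)
    show "\<exists>w\<in>?G. ?g w = ?f z" if "z \<in> ?F" for z
      using FG[OF that] by metis
  qed (rule obj)
  \<comment> \<open>Every \<open>u\<close> that is CCR feasible together with \<open>v\<close>
    qualifies. This covers both \<open>u = u'\<close> with \<open>t' = 1\<close> and the
    \<open>u\<close> obtained from \<open>lift\<close>.\<close>
  have optG: "optimal_solution ?G ?g (u, v)"
    if "optimal_solution ?F ?f (u', v, t')" and "(u, v) \<in> ?G" for u u' v t'
    using that(1) that(2) obj[symmetric] GF by (rule optimal_solution_transfer)
  show ?thesis
  proof (intro conjI allI impI iffI)
    show "optimal_value ?F ?f = optimal_value ?G ?g"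
      using FG GF by (rule optimal_value_eqI)
  next
    fix u v
    assume "optimal_solution ?F ?f (u, v, 1)"
    then show "optimal_solution ?G ?g (u, v)"
      using optG ccr_feasible_iff_mm_dea_feasible by (metis optimal_solution_iff)
  next
    fix u' v t'
    assume "optimal_solution ?F ?f (u', v, t')"
    then show "\<exists>u. optimal_solution ?G ?g (u, v)"
      using lift optG by (metis optimal_solution_iff)
  next
    fix u' v t'
    assume "(u', v, t') \<in> ?F"
    then show "\<exists>u. (u, v) \<in> ?G \<and> ?g (u, v) = ?f (u', v, t')"
      using lift obj by metis
  qed (use ccr_feasible_iff_mm_dea_feasible obj optF in blast)+
qed

end
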